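(* Let $A,B$ be sets and let $\ell:A\nrightarrow B$, $r:B\nrightarrow A$ be loose morphisms in $\mathbf{Mly}$ forming a loose adjunction $\ell\dashv r$. Then the carriers of both $\ell$ and $r$ are singletons, and there is a function $f:A\to B$ such that $\ell$ is the companion of $f$ and $r$ is the conjoint of $f$. In other words, the only loose adjunctions in $\mathbf{Mly}$ are those given by companion–conjoint pairs.
   Context: $\mathbf{Mly}$ is the pseudo double category of Mealy automata in the category of sets. Its objects are sets and its tight morphisms are functions. A loose morphism $A\nrightarrow B$ is a triple $(E,d,s)$ with $E$ a set (the carrier) and $d:A\times E\to E$, $s:A\times E\to B$ functions. A cell from $(E,d,s):A\nrightarrow B$ to $(E',d',s'):X\nrightarrow Y$ with left tight side $f:A\to X$ and right tight side $g:B\to Y$ is a function $\alpha:E\to E'$ with $\alpha(d(a,e))=d'(f(a),\alpha(e))$ and $g(s(a,e))=s'(f(a),\alpha(e))$. The loose identity $\iota_A$ has a singleton as carrier and output map the projection to $A$. The loose composite of $(E,d,s):A\nrightarrow B$ followed by $(F,d',s'):B\nrightarrow C$ has carrier $E\times F$ and maps $(a,(e,x))\mapsto (d(a,e),d'(s(a,e),x))$ and $(a,(e,x))\mapsto s'(s(a,e),x)$. Vertical composition of cells is composition of functions, and horizontal composition is the product of functions. A loose adjunction $\ell\dashv r$ consists of loose morphisms $\ell:A\nrightarrow B$, $r:B\nrightarrow A$ with cells, having identity tight sides, $\eta$ from $\iota_A$ to the composite of $\ell$ followed by $r$, and $\epsilon$ from the composite of $r$ followed by $\ell$ to $\iota_B$,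 satisfying the two triangle (zig-zag) identities (i.e. an adjunction in the bicategory of loose morphisms). The companion of a tight morphism $f:A\to B$ is a loose morphism $f_*:A\nrightarrow B$ with cells $\epsilon_f:f_*\Rightarrow\iota_B$ (left side $f$, right side $\mathrm{id}_B$) and $\eta_f:\iota_A\Rightarrow f_*$ (left side $\mathrm{id}_A$, right side $f$), such that their vertical composite is the identity cell of $f$ and their horizontal composite is (up to unitors) the identity cell of $f_*$. Dually, the conjoint of $f$ is a loose morphism $f^*:B\nrightarrow A$ with cells $f^*\Rightarrow\iota_B$ (left side $\mathrm{id}_B$, right side $f$) and $\iota_A\Rightarrow f^*$ (left side $f$, right side $\mathrm{id}_A$) satisfying the analogous two identities. Companions and conjoints are unique up to isomorphism. *)

theory Defs
  imports Main "HOL-Library.FuncSet"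
begin

text \<open>
  Objects are sets \<open>A :: 'a set\<close> (possibly empty), so functions are only meaningful on the
  relevant sets: being a function is membership in \<open>\<rightarrow>\<close>, and equations between
  functions are required on their domain only.  Loose composites are written in diagrammatic order.
\<close>

record ('a, 'b, 'e) mealy =
  carrier :: "'e set"
  dyn :: "'a \<times> 'e \<Rightarrow> 'e"
  out :: "'a \<times> 'e \<Rightarrow> 'b"

definition loose :: "'a set \<Rightarrow> 'b set \<Rightarrow> ('a, 'b, 'e) mealy \<Rightarrow> bool" where
  "loose A B L \<longleftrightarrow>
     dyn L \<in> A \<times> carrier L \<rightarrow> carrier L \<and> out L \<in> A \<times> carrier L \<rightarrow> B"

definition loose_id :: "('a, 'a, unit) mealy" where
  "loose_id = \<lparr>carrier = {()}, dyn = (\<lambda>(a, u). u), out = (\<lambda>(a, u). a)\<rparr>"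

definition loose_comp ::
  "('a, 'b, 'e) mealy \<Rightarrow> ('b, 'c, 'f) mealy \<Rightarrow> ('a, 'c, 'e \<times> 'f) mealy" (infixr ";;" 60) where
  "L ;; M =
     \<lparr>carrier = carrier L \<times> carrier M,
      dyn = (\<lambda>(a, (e, x)). (dyn L (a, e), dyn M (out L (a, e), x))),
      out = (\<lambda>(a, (e, x)). out M (out L (a, e), x))\<rparr>"

text \<open>
  \<open>cell A B X Y f g L M \<alpha>\<close>: \<open>\<alpha>\<close> is a cell from the loose morphism \<open>L\<close> from \<open>A\<close> to \<open>B\<close> to the
  loose morphism \<open>M\<close> from \<open>X\<close> to \<open>Y\<close>, with left side \<open>f\<close> and right side \<open>g\<close>.
\<close>

definition cell ::
  "'a set \<Rightarrow> 'b set \<Rightarrow> 'x set \<Rightarrow> 'y set \<Rightarrow> ('a \<Rightarrow> 'x) \<Rightarrow> ('b \<Rightarrow> 'y) \<Rightarrow>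
   ('a, 'b, 'e) mealy \<Rightarrow> ('x, 'y, 'f) mealy \<Rightarrow> ('e \<Rightarrow> 'f) \<Rightarrow> bool" where
  "cell A B X Y f g L M \<alpha> \<longleftrightarrow>
     loose A B L \<and> loose X Y M \<and> f \<in> A \<rightarrow> X \<and> g \<in> B \<rightarrow> Y \<and>
     \<alpha> \<in> carrier L \<rightarrow> carrier M \<and>
     (\<forall>a\<in>A. \<forall>e\<in>carrier L.
        \<alpha> (dyn L (a, e)) = dyn M (f a, \<alpha> e) \<and> g (out L (a, e)) = out M (f a, \<alpha> e))"

definition cell_eq :: "('a, 'b, 'e) mealy \<Rightarrow> ('e \<Rightarrow> 'f) \<Rightarrow> ('e \<Rightarrow> 'f) \<Rightarrow> bool" where
  "cell_eq L \<alpha> \<beta> \<longleftrightarrow> (\<forall>e\<in>carrier L. \<alpha> e = \<beta> e)"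

abbreviation vcomp :: "('f \<Rightarrow> 'g) \<Rightarrow> ('e \<Rightarrow> 'f) \<Rightarrow> 'e \<Rightarrow> 'g" (infixl "\<bullet>" 55) where
  "\<beta> \<bullet> \<alpha> \<equiv> \<beta> \<circ> \<alpha>"

abbreviation hcomp :: "('e \<Rightarrow> 'e1) \<Rightarrow> ('f \<Rightarrow> 'f1) \<Rightarrow> 'e \<times> 'f \<Rightarrow> 'e1 \<times> 'f1" (infixr "\<parallel>" 60) where
  "\<alpha> \<parallel> \<beta> \<equiv> map_prod \<alpha> \<beta>"

text \<open>The coherence isomorphisms are those of the cartesian product of carriers.\<close>

definition lunit :: "unit \<times> 'e \<Rightarrow> 'e" where "lunit = (\<lambda>(u, e). e)"
definition lunit_inv :: "'e \<Rightarrow> unit \<times> 'e" where "lunit_inv = (\<lambda>e. ((), e))"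
definition runit :: "'e \<times> unit \<Rightarrow> 'e" where "runit = (\<lambda>(e, u). e)"
definition runit_inv :: "'e \<Rightarrow> 'e \<times> unit" where "runit_inv = (\<lambda>e. (e, ()))"
definition assoc :: "('e \<times> 'f) \<times> 'g \<Rightarrow> 'e \<times> ('f \<times> 'g)" where
  "assoc = (\<lambda>((e, x), y). (e, (x, y)))"
definition assoc_inv :: "'e \<times> ('f \<times> 'g) \<Rightarrow> ('e \<times> 'f) \<times> 'g" where
  "assoc_inv = (\<lambda>(e, (x, y)). ((e, x), y))"

definition loose_adjunction ::
  "'a set \<Rightarrow> 'b set \<Rightarrow> ('a, 'b, 'e) mealy \<Rightarrow> ('b, 'a, 'f) mealy \<Rightarrow>
   (unit \<Rightarrow> 'e \<times> 'f) \<Rightarrow> ('f \<times> 'e \<Rightarrow> unit) \<Rightarrow> bool" where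
  "loose_adjunction A B l r \<eta> \<epsilon> \<longleftrightarrow>
     loose A B l \<and> loose B A r \<and>
     cell A A A A id id loose_id (l ;; r) \<eta> \<and>
     cell B B B B id id (r ;; l) loose_id \<epsilon> \<and>
     cell_eq l (runit \<bullet> (id \<parallel> \<epsilon>) \<bullet> assoc \<bullet> (\<eta> \<parallel> id) \<bullet> lunit_inv) id \<and>
     cell_eq r (lunit \<bullet> (\<epsilon> \<parallel> id) \<bullet> assoc_inv \<bullet> (id \<parallel> \<eta>) \<bullet> runit_inv) id"

text \<open>
  The cell \<open>id\<close> on \<open>loose_id\<close>, with both sides \<open>f\<close>, is the identity cell of the tight
  morphism \<open>f\<close>.
\<close>

definition is_companion :: "'a set \<Rightarrow> 'b set \<Rightarrow> ('a \<Rightarrow> 'b) \<Rightarrow> ('a, 'b, 'e) mealy \<Rightarrow> bool" where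
  "is_companion A B f L \<longleftrightarrow>
     f \<in> A \<rightarrow> B \<and> loose A B L \<and>
     (\<exists>\<epsilon> \<eta>.
        cell A B B B f id L loose_id \<epsilon> \<and>
        cell A A A B id f loose_id L \<eta> \<and>
        cell_eq (loose_id :: ('a, 'a, unit) mealy) (\<epsilon> \<bullet> \<eta>) id \<and>
        cell_eq L (runit \<bullet> (\<eta> \<parallel> \<epsilon>) \<bullet> lunit_inv) id)"

definition is_conjoint :: "'a set \<Rightarrow> 'b set \<Rightarrow> ('a \<Rightarrow> 'b) \<Rightarrow> ('b, 'a, 'e) mealy \<Rightarrow> bool" where
  "is_conjoint A B f L \<longleftrightarrow>
     f \<in> A \<rightarrow> B \<and> loose B A L \<and>
     (\<exists>\<epsilon> \<eta>.
        cell B A B B id f L loose_id \<epsilon> \<and>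
        cell A A B A f id loose_id L \<eta> \<and>
        cell_eq (loose_id :: ('a, 'a, unit) mealy) (\<epsilon> \<bullet> \<eta>) id \<and>
        cell_eq L (lunit \<bullet> (\<epsilon> \<parallel> \<eta>) \<bullet> runit_inv) id)"

end

(* The zig-zag identities force every state of l and of r to equal the corresponding component of
   the state picked by the unit, so both carriers are singletons.  A Mealy automaton with one state
   is just a function, and the output equations for unit and counit say that the functions of l and
   r are mutually inverse. *)
theory Submission
  imports Defs
begin

text \<open>Since \<open>\<epsilon>\<close> takes values in \<open>unit\<close>, each zig-zag
  composite discards its argument and returns a component of \<open>\<eta> ()\<close>; a constant
  map equal to the identity leaves at most one state.\<close>

lemma loose_adjunction_carriers:
  assumes "loose_adjunction A B l r \<eta> \<epsilon>"
  shows "carrier l = {fst (\<eta> ())}" and "carrier r = {snd (\<eta> ())}"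
proof -
  \<comment> \<open>This membership makes both carriers nonempty.\<close>
  have "\<eta> () \<in> carrier l \<times> carrier r"
    using assms by (auto simp: loose_adjunction_def cell_def loose_id_def loose_comp_def)
  moreover have "e = fst (\<eta> ())" if "e \<in> carrier l" for e
    using assms that
    by (auto simp: loose_adjunction_def cell_eq_def lunit_inv_def assoc_def runit_def split_beta)
  moreover have "x = snd (\<eta> ())" if "x \<in> carrier r" for x
    using assms that
    by (auto simp: loose_adjunction_def cell_eq_def runit_inv_def assoc_inv_def lunit_def split_beta)
  ultimately show "carrier l = {fst (\<eta> ())}" and "carrier r = {snd (\<eta> ())}"
    by (auto simp: mem_Times_iff)
qed

text \<open>With a single state the dynamics is forced, and the structure cells are the only maps
  between singletons; their output equations hold by the choice of function.\<close>

lemma is_companion_one_state: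
  assumes "loose A B l" and "carrier l = {e}"
  shows "is_companion A B (\<lambda>a. out l (a, e)) l"
proof -
  have "(\<lambda>a. out l (a, e)) \<in> A \<rightarrow> B" and "\<And>a. a \<in> A \<Longrightarrow> dyn l (a, e) = e"
    using assms by (auto simp: loose_def Pi_iff)
  then show ?thesis
    using assms unfolding is_companion_def
    by (intro conjI exI[of _ "\<lambda>_. ()"] exI[of _ "\<lambda>_. e"])
      (auto simp: cell_def cell_eq_def loose_def loose_id_def runit_def lunit_inv_def)
qed

text \<open>The last two hypotheses are exactly the output equations of the conjoint cells,
  \<open>\<eta>\<close> and \<open>\<epsilon>\<close> in this order.\<close>

lemma is_conjoint_one_state:
  assumes "f \<in> A \<rightarrow> B" and "loose B A r" and "carrier r = {x}"
    and "\<And>a. a \<in> A \<Longrightarrow> out r (f a, x) = a"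
    and "\<And>b. b \<in> B \<Longrightarrow> f (out r (b, x)) = b"
  shows "is_conjoint A B f r"
proof -
  have "\<And>b. b \<in> B \<Longrightarrow> dyn r (b, x) = x"
    using assms by (auto simp: loose_def Pi_iff)
  then show ?thesis
    using assms unfolding is_conjoint_def
    by (intro conjI exI[of _ "\<lambda>_. ()"] exI[of _ "\<lambda>_. x"])
      (auto simp: cell_def cell_eq_def loose_def loose_id_def lunit_def runit_inv_def Pi_iff)
qed

theorem mainTheorem5:
  fixes A :: "'a set" and B :: "'b set"
    and l :: "('a, 'b, 'e) mealy" and r :: "('b, 'a, 'f) mealy"
  assumes "loose A B l" and "loose B A r"
    and "\<exists>\<eta> \<epsilon>. loose_adjunction A B l r \<eta> \<epsilon>"
  shows "is_singleton (carrier l) \<and> is_singleton (carrier r) \<and>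
    (\<exists>f \<in> A \<rightarrow> B. is_companion A B f l \<and> is_conjoint A B f r)"
proof -
  obtain \<eta> \<epsilon> where adj: "loose_adjunction A B l r \<eta> \<epsilon>"
    using assms(3) by blast
  obtain e x where \<eta>: "\<eta> () = (e, x)"
    by fastforce
  have l: "carrier l = {e}" and r: "carrier r = {x}"
    using loose_adjunction_carriers[OF adj] \<eta> by auto
  define f where "f = (\<lambda>a. out l (a, e))"
  have comp: "is_companion A B f l"
    using is_companion_one_state[OF assms(1) l] by (simp add: f_def)
  then have f: "f \<in> A \<rightarrow> B"
    by (simp add: is_companion_def)
  \<comment> \<open>Output equation of the unit of the adjunction.\<close>
  have "out r (f a, x) = a" if "a \<in> A" for a
    using adj that \<eta>
    by (auto simp: loose_adjunction_def cell_def loose_id_def loose_comp_def f_def)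
  \<comment> \<open>Output equation of the counit at \<open>(x, e)\<close>, the only state of
    \<open>r ;; l\<close>.\<close>
  moreover have "f (out r (b, x)) = b" if "b \<in> B" for b
    using adj that l r
    by (auto simp: loose_adjunction_def cell_def loose_id_def loose_comp_def f_def)
  ultimately have "is_conjoint A B f r"
    by (rule is_conjoint_one_state[OF f assms(2) r])
  then show ?thesis
    using l r f comp by auto
qed

end
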